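(* Let $\{\hat H_k\}\subseteq\mathbb R^{2\times2}$ be a sequence of positive definite symmetric matrices, and assume that there exist $0<\hat\nu_1\le\hat\nu_2$ such that $\hat\nu_1\le\lambda_{\min}(\hat H_k)$ and $(\hat H_k)_{11}\le\hat\nu_2$ for all $k$. Let $\{\eta_k\}$ be a sequence such that $\eta_{\min}\le\eta_k\le\eta_{\max}$ for all $k$, where $0<\eta_{\min}\le\eta_{\max}<+\infty$ are fixed, and assume $\eta_{\max}<\frac{2}{\hat\nu_1}$. Let $\{x_k\}\subseteq\mathcal S$ be the sequence of iterates and let, for each $k\ge1$, $$\hat d_k=\mathcal P_{\mathcal S}[x_k-\eta_k\nabla f(x_k)]-x_k,\qquad \hat s_k=\mathcal P_{\mathcal S}[x_k+(x_k-x_{k-1})]-x_k,$$ $$H_k=D_k\hat H_kD_k,\qquad D_k=\begin{bmatrix}\|\hat d_k\|&0\\0&\|\hat s_k\|\end{bmatrix},$$ and let $d_k=\alpha_k\hat d_k+\beta_k\hat s_k$, where $[\alpha_k\ \ \beta_k]^T$ is a solution of $$\min_{\alpha,\beta}\ \tfrac12\begin{bmatrix}\alpha\\\beta\end{bmatrix}^TH_k\begin{bmatrix}\alpha\\\beta\end{bmatrix}+\alpha\,\nabla f(x_k)^T\hat d_k+\beta\,\nabla f(x_k)^T\hat s_k\quad\text{s.t.}\quad\alpha+\beta\le1,\quad\alpha\ge0,\ \beta\ge0.$$ Then, for any $\eta\in[\eta_{\min},\eta_{\max}]$, the sequence of directions $\{d_k\}$ satisfies the direction assumption; that is, there exist constants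 $a,c_1,c_2>0$ such that, for all $k$: $x_k+\alpha d_k\in\mathcal S$ for all $\alpha\in[0,a]$; $\nabla f(x_k)^Td_k\le-c_1\|d_k\|^2$; and $\nabla f(x_k)^Td_k\le-c_2\|\mathcal P_{\mathcal S}[x_k-\eta\nabla f(x_k)]-x_k\|^2$.
   Context: Setting: $\mathcal S\subset\mathbb R^n$ is a (nonempty) closed convex set; $f:\mathbb R^n\to\mathbb R$ is smooth, possibly nonconvex, bounded below over $\mathcal S$, and $\nabla f$ is Lipschitz continuous with constant $L$ on an open convex set $\mathcal D\supseteq\mathcal S$. $\mathcal P_{\mathcal S}[x]=\arg\min_{y\in\mathcal S}\|x-y\|$ is the Euclidean projection; norms are Euclidean. $\lambda_{\min}$ denotes the smallest eigenvalue. *)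

theory Defs
  imports "HOL-Analysis.Analysis"
begin

definition eigenval :: "real^'n^'n \<Rightarrow> real \<Rightarrow> bool" where
  "eigenval A c \<longleftrightarrow> (\<exists>v. v \<noteq> 0 \<and> A *v v = c *\<^sub>R v)"

text \<open>
  Meaningful only if \<open>A\<close> has a real eigenvalue (\<open>Min {}\<close> is unspecified);
  it is used here for symmetric matrices, all of whose eigenvalues are real.
\<close>
definition lambda_min :: "real^'n^'n \<Rightarrow> real" where
  "lambda_min A = Min {c. eigenval A c}"

definition pos_def :: "real^'n^'n \<Rightarrow> bool" where
  "pos_def A \<longleftrightarrow> (\<forall>v. v \<noteq> 0 \<longrightarrow> v \<bullet> (A *v v) > 0)"

text \<open>
  The direction assumption for the directions \<open>d k\<close> at the points \<open>x k\<close>, where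
  \<open>g\<close> is the gradient of the objective.  The index starts at 1 because the
  directions of interest depend on \<open>x (k - 1)\<close>.
\<close>
definition direction_assumption ::
    "(real^'n) set \<Rightarrow> (real^'n \<Rightarrow> real^'n) \<Rightarrow> real \<Rightarrow> (nat \<Rightarrow> real^'n) \<Rightarrow> (nat \<Rightarrow> real^'n) \<Rightarrow> bool" where
  "direction_assumption S g \<eta> x d \<longleftrightarrow>
    (\<exists>a c\<^sub>1 c\<^sub>2. a > 0 \<and> c\<^sub>1 > 0 \<and> c\<^sub>2 > 0 \<and>
      (\<forall>k\<ge>1.
        (\<forall>t\<in>{0..a}. x k + t *\<^sub>R d k \<in> S) \<and>
        g (x k) \<bullet> d k \<le> - c\<^sub>1 * (norm (d k))\<^sup>2 \<and>
        g (x k) \<bullet> d k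
          \<le> - c\<^sub>2 * (norm (closest_point S (x k - \<eta> *\<^sub>R g (x k)) - x k))\<^sup>2))"

end

theory Submission
  imports Defs
begin

text \<open>
  Write \<open>g\<close> for the gradient at \<open>x\<close> and \<open>u = (\<alpha>, \<beta>)\<close>.  Since the feasible triangle is star-shaped
  around the origin, comparing \<open>u\<close> with \<open>t u\<close> gives \<open>g \<bullet> d \<le> - u \<bullet> H u\<close>, and the bound on the smallest
  eigenvalue of \<open>Hhat\<close> turns the right-hand side into \<open>- \<nu>\<^sub>1 / 2 * (norm d)\<^sup>2\<close>.  Comparing \<open>u\<close> with
  \<open>(t, 0)\<close> for \<open>t = min 1 (1 / (\<nu>\<^sub>2 \<eta>\<^sub>m\<^sub>a\<^sub>x))\<close> bounds \<open>g \<bullet> d\<close> by a negative multiple of \<open>(norm dhat)\<^sup>2\<close>,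
  and the lengths of projected gradient steps for two step sizes are comparable up to the ratio of
  the step sizes.
\<close>

section \<open>Smallest eigenvalue of a symmetric matrix as a lower bound for its quadratic
  form\<close>

lemma symmetric_dot_commute:
  fixes A :: "real^'n^'n"
  assumes "transpose A = A"
  shows "v \<bullet> (A *v w) = w \<bullet> (A *v v)"
  using assms by (metis dot_lmul_matrix inner_commute transpose_matrix_vector)

text \<open>Eigenvectors for distinct eigenvalues are orthogonal, hence independent, so there are at
  most as many eigenvalues as dimensions. Finiteness is what makes the \<open>Min\<close> in
  \<open>lambda_min\<close> a genuine lower bound for every eigenvalue.\<close>

lemma finite_eigenval_symmetric:
  fixes A :: "real^'n^'n"
  assumes A: "transpose A = A"
  shows "finite {c. eigenval A c}"
proof -
  define v where "v c = (SOME v. v \<noteq> 0 \<and> A *v v = c *\<^sub>R v)" for c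
  have v: "v c \<noteq> 0 \<and> A *v v c = c *\<^sub>R v c" if "eigenval A c" for c
    using that unfolding v_def eigenval_def by (rule someI_ex)
  have orth: "v b \<bullet> v c = 0" if "eigenval A b" "eigenval A c" "b \<noteq> c" for b c
  proof -
    have "c * (v b \<bullet> v c) = b * (v b \<bullet> v c)"
      using symmetric_dot_commute[OF A, of "v b" "v c"] v that by (simp add: inner_commute)
    then show ?thesis using that by simp
  qed
  let ?E = "{c. eigenval A c}"
  have "inj_on v ?E"
    by (rule inj_onI) (metis inner_eq_zero_iff mem_Collect_eq orth v)
  moreover have "pairwise orthogonal (v ` ?E)" "0 \<notin> v ` ?E"
    using orth v by (auto simp: pairwise_def orthogonal_def)
  then have "finite (v ` ?E)"
    using pairwise_orthogonal_independent independent_bound by blast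
  ultimately show ?thesis
    using finite_imageD by blast
qed

text \<open>A null vector \<open>v\<close> of the form is a minimiser; if \<open>B *v v\<close> were
  nonzero, moving from \<open>v\<close> against it would make the form negative to first order. This
  turns a minimiser of the Rayleigh quotient into an eigenvector.\<close>

lemma psd_null_vector:
  fixes B :: "real^'n^'n"
  assumes B: "transpose B = B" and psd: "\<And>w. 0 \<le> w \<bullet> (B *v w)" and v: "v \<bullet> (B *v v) = 0"
  shows "B *v v = 0"
proof -
  define w where "w = B *v v"
  define a where "a = w \<bullet> (B *v w)"
  have *: "0 \<le> - (2 * t) * (w \<bullet> w) + t\<^sup>2 * a" for t
  proof -
    have "(v - t *\<^sub>R w) \<bullet> (B *v (v - t *\<^sub>R w)) = - (2 * t) * (w \<bullet> w) + t\<^sup>2 * a"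
      using symmetric_dot_commute[OF B, of v w] v
      by (simp add: a_def w_def[symmetric] matrix_vector_mult_diff_distrib
          matrix_vector_mult_scaleR inner_simps algebra_simps power2_eq_square)
    then show ?thesis by (metis psd)
  qed
  have a: "a \<ge> 0" unfolding a_def by (rule psd)
  have "w = 0"
  proof (rule ccontr)
    assume "w \<noteq> 0"
    then have ww: "w \<bullet> w > 0" by simp
    \<comment> \<open>This choice gives \<open>t * a < w \<bullet> w\<close>, so the quadratic term
      cannot offset the linear one; the \<open>+ 1\<close> covers the case
      \<open>a = 0\<close>.\<close>
    define t where "t = (w \<bullet> w) / (a + 1)"
    have t: "t > 0" "t * (a + 1) = w \<bullet> w" using ww a by (auto simp: t_def)
    have "- (2 * t) * (w \<bullet> w) + t\<^sup>2 * a = t * (t * (a + 1) - t - 2 * (w \<bullet> w))"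
      by (simp add: algebra_simps power2_eq_square)
    also have "\<dots> < 0"
      unfolding t(2) using t(1) ww by (intro mult_pos_neg) linarith+
    finally show False using *[of t] by simp
  qed
  then show ?thesis by (simp add: w_def)
qed

text \<open>By compactness the Rayleigh quotient attains its minimum \<open>m\<close> at a unit
  vector \<open>v\<close>. Then \<open>A - m *\<^sub>R mat 1\<close> is positive semidefinite with
  null vector \<open>v\<close>, so \<open>m\<close> is an eigenvalue and bounds
  \<open>lambda_min A\<close> from above.\<close>

lemma lambda_min_le_quadratic_form:
  fixes A :: "real^'n^'n"
  assumes A: "transpose A = A"
  shows "lambda_min A * (w \<bullet> w) \<le> w \<bullet> (A *v w)"
proof -
  have "sphere (0::real^'n) 1 \<noteq> {}" by simp
  moreover have "continuous_on (sphere 0 1) (\<lambda>v. v \<bullet> (A *v v))"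
    by (intro continuous_intros linear_continuous_on_compose[OF _ matrix_vector_mul_linear])
  ultimately obtain v where v: "norm v = 1"
    and min: "\<And>u. norm u = 1 \<Longrightarrow> v \<bullet> (A *v v) \<le> u \<bullet> (A *v u)"
    using continuous_attains_inf[OF compact_sphere[of "0::real^'n" 1], of "\<lambda>v. v \<bullet> (A *v v)"] by auto
  define m where "m = v \<bullet> (A *v v)"
  have m: "m * (u \<bullet> u) \<le> u \<bullet> (A *v u)" for u
  proof (cases "u = 0")
    case False
    have "m \<le> (u /\<^sub>R norm u) \<bullet> (A *v (u /\<^sub>R norm u))"
      unfolding m_def using False by (intro min) simp
    also have "\<dots> = (u \<bullet> (A *v u)) / (u \<bullet> u)"
      by (simp add: matrix_vector_mult_scaleR dot_square_norm power2_eq_square divide_simps)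
    finally show ?thesis using False by (simp add: field_simps)
  qed simp
  define B where "B = A - m *\<^sub>R mat 1"
  have Bv: "B *v u = A *v u - m *\<^sub>R u" for u
    by (simp add: B_def matrix_vector_mult_diff_rdistrib scaleR_matrix_vector_assoc[symmetric])
  have "transpose B = B"
    using A by (simp add: B_def transpose_def vec_eq_iff mat_def eq_commute)
  then have "B *v v = 0"
    by (rule psd_null_vector) (use m v in \<open>auto simp: Bv inner_diff_right m_def dot_square_norm\<close>)
  then have "eigenval A m"
    unfolding eigenval_def using v by (intro exI[of _ v]) (auto simp: Bv)
  then have "lambda_min A \<le> m"
    unfolding lambda_min_def using finite_eigenval_symmetric[OF A] by simp
  then show ?thesis
    by (meson m inner_ge_zero mult_right_mono order_trans)
qed

section \<open>Projected gradient steps\<close>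

text \<open>This is the variational inequality of the projection, tested at the point
  \<open>x\<close> of \<open>S\<close> itself.\<close>

lemma projected_step_descent:
  fixes S :: "'a::euclidean_space set"
  assumes "convex S" "closed S" "x \<in> S"
  shows "\<eta> * (g \<bullet> (closest_point S (x - \<eta> *\<^sub>R g) - x))
    \<le> - (norm (closest_point S (x - \<eta> *\<^sub>R g) - x))\<^sup>2"
  using closest_point_dot[OF assms, of "x - \<eta> *\<^sub>R g"]
  by (simp add: inner_simps power2_norm_eq_inner inner_commute algebra_simps)

text \<open>Each projection's variational inequality is tested at the other projection. The result
  lets a fixed step size replace the varying \<open>\<eta>s k\<close>.\<close>

lemma projected_step_norm_le:
  fixes S :: "'a::euclidean_space set"
  assumes S: "convex S" "closed S" "S \<noteq> {}" and s: "s > 0" and t: "t > 0"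
  shows "norm (closest_point S (x - s *\<^sub>R g) - x)
    \<le> max 1 (s / t) * norm (closest_point S (x - t *\<^sub>R g) - x)"
proof -
  define y where "y = closest_point S (x - s *\<^sub>R g)"
  define z where "z = closest_point S (x - t *\<^sub>R g)"
  define a where "a = y - x"
  define b where "b = z - x"
  have yz: "y \<in> S" "z \<in> S"
    unfolding y_def z_def using S by (auto intro: closest_point_in_set)
  have "(x - s *\<^sub>R g - y) \<bullet> (z - y) \<le> 0" "(x - t *\<^sub>R g - z) \<bullet> (y - z) \<le> 0"
    unfolding y_def z_def using closest_point_dot[OF S(1,2)] yz by (auto simp: y_def z_def)
  then have le: "(- a - s *\<^sub>R g) \<bullet> (b - a) \<le> 0" "(- b - t *\<^sub>R g) \<bullet> (a - b) \<le> 0"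
    by (simp_all add: a_def b_def algebra_simps)
  \<comment> \<open>The weights \<open>t\<close> and \<open>s\<close> are chosen so that the terms
    containing \<open>g\<close> cancel.\<close>
  have "t * ((- a - s *\<^sub>R g) \<bullet> (b - a)) + s * ((- b - t *\<^sub>R g) \<bullet> (a - b)) \<le> 0"
    using le s t by (intro add_nonpos_nonpos mult_nonneg_nonpos) auto
  then have "t * (a \<bullet> a) + s * (b \<bullet> b) \<le> (s + t) * (a \<bullet> b)"
    by (simp add: inner_simps inner_commute algebra_simps)
  also have "\<dots> \<le> (s + t) * (norm a * norm b)"
    using s t by (intro mult_left_mono norm_cauchy_schwarz) auto
  \<comment> \<open>The quadratic in the two norms factors, which confines \<open>norm a\<close> to
    the interval between \<open>norm b\<close> and \<open>s / t * norm b\<close>.\<close>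
  finally have *: "(t * norm a - s * norm b) * (norm a - norm b) \<le> 0"
    by (simp add: dot_square_norm algebra_simps power2_eq_square)
  have "norm a \<le> max 1 (s / t) * norm b"
  proof (rule ccontr)
    assume "\<not> ?thesis"
    moreover have "norm b \<le> max 1 (s / t) * norm b" "s / t * norm b \<le> max 1 (s / t) * norm b"
      using mult_right_mono[of 1 "max 1 (s / t)" "norm b"]
        mult_right_mono[of "s / t" "max 1 (s / t)" "norm b"] by auto
    ultimately have "norm a - norm b > 0" "s / t * norm b < norm a" by linarith+
    then have "(t * norm a - s * norm b) * (norm a - norm b) > 0"
      using t by (intro mult_pos_pos) (auto simp: field_simps)
    with * show False by simp
  qed
  then show ?thesis by (simp add: a_def b_def y_def z_def)
qed

section \<open>Feasibility of combined directions and the two-variable subproblem\<close>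

text \<open>The point lies on the segment from \<open>x\<close> to a point \<open>z\<close> between
  \<open>x + v\<close> and \<open>x + w\<close>; normalising the weights of \<open>z\<close>
  requires \<open>a + b\<close> to be nonzero.\<close>

lemma convex_two_directions:
  assumes S: "convex S" and mem: "x \<in> S" "x + v \<in> S" "x + w \<in> S"
    and ab: "0 \<le> a" "0 \<le> b" "a + b \<le> 1"
  shows "x + (a *\<^sub>R v + b *\<^sub>R w) \<in> S"
proof (cases "a + b = 0")
    case True
    then have "a = 0" "b = 0" using ab by auto
    then show ?thesis using mem by simp
  next
    case False
    define z where "z = (a / (a + b)) *\<^sub>R (x + v) + (b / (a + b)) *\<^sub>R (x + w)"
    have "z \<in> S"
      unfolding z_def using S mem ab False by (intro mem_convex_alt) auto
    then have "(1 - (a + b)) *\<^sub>R x + (a + b) *\<^sub>R z \<in> S"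
      using S mem ab by (intro convexD_alt) auto
    moreover have "(a + b) *\<^sub>R z = a *\<^sub>R (x + v) + b *\<^sub>R (x + w)"
      using False by (simp add: z_def scaleR_right_distrib[of "a + b"])
    ultimately show ?thesis by (simp add: algebra_simps)
qed

text \<open>Moving the scaling from the matrix to the vector makes bounds on \<open>A\<close>
  applicable even if \<open>p\<close> or \<open>q\<close> vanishes and the scaled matrix is
  singular.\<close>

lemma diagonal_congruence_form:
  fixes A :: "real^2^2"
  defines "D \<equiv> \<lambda>p q. vector [vector [p, 0], vector [0, q]] :: real^2^2"
  shows "u \<bullet> ((D p q ** A ** D p q) *v u)
    = vector [p * u$1, q * u$2] \<bullet> (A *v vector [p * u$1, q * u$2])"
  by (simp add: D_def inner_vec_def matrix_vector_mult_def matrix_matrix_mult_def sum_2 vector_2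
      algebra_simps)

lemma vector_2_dot_self: "(vector [a, b] :: real^2) \<bullet> vector [a, b] = a\<^sup>2 + b\<^sup>2"
  by (simp add: inner_vec_def sum_2 vector_2 power2_eq_square)

text \<open>The derivative of the right-hand side at \<open>t = 1\<close> is \<open>Q + l\<close>;
  it cannot be positive when the minimum over the unit interval is attained there.\<close>

lemma quadratic_min_on_ray:
  fixes Q l :: real
  assumes min: "\<And>t. 0 \<le> t \<Longrightarrow> t \<le> 1 \<Longrightarrow> Q / 2 + l \<le> t\<^sup>2 * (Q / 2) + t * l" and Q: "Q \<ge> 0"
  shows "l \<le> - Q"
proof (rule ccontr)
  assume "\<not> l \<le> - Q"
  \<comment> \<open>Stepping back from 1 by \<open>e\<close> gains \<open>e * (Q + l)\<close> and
    loses \<open>e\<^sup>2 * Q / 2\<close>; the choice of \<open>e\<close> makes the gain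
    larger.\<close>
  define e where "e = min 1 ((Q + l) / (Q + 1))"
  have e: "0 < e" "e \<le> 1" "e \<le> (Q + l) / (Q + 1)"
    using \<open>\<not> l \<le> - Q\<close> Q by (auto simp: e_def)
  have e': "e * (Q + 1) \<le> Q + l"
    using e(3) Q by (simp add: pos_le_divide_eq)
  have "Q / 2 + l \<le> (1 - e)\<^sup>2 * (Q / 2) + (1 - e) * l"
    using e by (intro min) auto
  then have "e * (Q + l) \<le> e * (e * Q / 2)"
    by (simp add: power2_eq_square field_simps)
  then have "Q + l \<le> e * Q / 2" using e(1) by simp
  moreover have "e * Q \<ge> 0" using e Q by simp
  ultimately show False using e(1) e' by (simp add: algebra_simps)
qed

text \<open>One iteration in isolation: \<open>p\<close> and \<open>q\<close> stand for the lengths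
  of the two directions, \<open>l\<^sub>1\<close> and \<open>l\<^sub>2\<close> for the slopes along
  them, and \<open>h\<close> for an upper bound on the step sizes. The constants depend only on
  \<open>\<nu>\<^sub>1\<close>, \<open>\<nu>\<^sub>2\<close> and \<open>h\<close>, hence are uniform
  over the iterates.\<close>

lemma subproblem_solution_bounds:
  fixes A :: "real^2^2" and p q a b l\<^sub>1 l\<^sub>2 :: real
  defines "M \<equiv> vector [vector [p, 0], vector [0, q]] :: real^2^2"
  assumes A: "transpose A = A" and nu: "0 < \<nu>\<^sub>1" "\<nu>\<^sub>1 \<le> lambda_min A" "0 < \<nu>\<^sub>2" "A$1$1 \<le> \<nu>\<^sub>2"
    and h: "0 < h" "h * l\<^sub>1 \<le> - p\<^sup>2"
    and opt: "is_arg_min (\<lambda>u. 1/2 * (u \<bullet> ((M ** A ** M) *v u)) + u$1 * l\<^sub>1 + u$2 * l\<^sub>2)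
        (\<lambda>u. u$1 + u$2 \<le> 1 \<and> u$1 \<ge> 0 \<and> u$2 \<ge> 0) (vector [a, b] :: real^2)"
  shows "a * l\<^sub>1 + b * l\<^sub>2 \<le> - \<nu>\<^sub>1 * ((a * p)\<^sup>2 + (b * q)\<^sup>2)"
    and "a * l\<^sub>1 + b * l\<^sub>2 \<le> - (min 1 (1 / (\<nu>\<^sub>2 * h)) / (2 * h)) * p\<^sup>2"
proof -
  have ab: "a + b \<le> 1" "a \<ge> 0" "b \<ge> 0"
    using opt by (auto simp: is_arg_min_def vector_2)
  define \<phi> where "\<phi> u = 1/2 * (vector [p * u$1, q * u$2] \<bullet> (A *v vector [p * u$1, q * u$2]))
      + u$1 * l\<^sub>1 + u$2 * l\<^sub>2" for u :: "real^2"
  have min: "\<phi> (vector [a, b]) \<le> \<phi> (vector [a', b'])" if "a' + b' \<le> 1" "a' \<ge> 0" "b' \<ge> 0" for a' b'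
  proof -
    have "is_arg_min \<phi> (\<lambda>u. u$1 + u$2 \<le> 1 \<and> u$1 \<ge> 0 \<and> u$2 \<ge> 0) (vector [a, b])"
      using opt unfolding M_def diagonal_congruence_form \<phi>_def .
    then have "\<not> \<phi> (vector [a', b']) < \<phi> (vector [a, b])"
      using that unfolding is_arg_min_def by (metis vector_2)
    then show ?thesis by simp
  qed
  define Q where "Q = vector [p * a, q * b] \<bullet> (A *v vector [p * a, q * b])"
  have "\<nu>\<^sub>1 * ((p * a)\<^sup>2 + (q * b)\<^sup>2) \<le> lambda_min A * ((p * a)\<^sup>2 + (q * b)\<^sup>2)"
    using nu by (intro mult_right_mono) auto
  also have "\<dots> \<le> Q"
    unfolding Q_def using lambda_min_le_quadratic_form[OF A, of "vector [p * a, q * b]"]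
    by (simp add: vector_2_dot_self)
  finally have Q: "\<nu>\<^sub>1 * ((p * a)\<^sup>2 + (q * b)\<^sup>2) \<le> Q" .
  moreover have "0 \<le> \<nu>\<^sub>1 * ((p * a)\<^sup>2 + (q * b)\<^sup>2)" using nu by simp
  ultimately have Q0: "Q \<ge> 0" by linarith
  define l where "l = a * l\<^sub>1 + b * l\<^sub>2"
  have "l \<le> - Q"
  proof (rule quadratic_min_on_ray[OF _ Q0])
    fix t :: real assume t: "0 \<le> t" "t \<le> 1"
    have "t * a + t * b \<le> 1"
      using ab t mult_mono[of t 1 "a + b" 1] by (simp add: distrib_left)
    then have "\<phi> (vector [a, b]) \<le> \<phi> (vector [t * a, t * b])"
      using ab t by (intro min) auto
    moreover have "vector [p * (t * a), q * (t * b)] = t *\<^sub>R (vector [p * a, q * b] :: real^2)"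
      by (simp add: vec_eq_iff forall_2 vector_2)
    ultimately show "Q / 2 + l \<le> t\<^sup>2 * (Q / 2) + t * l"
      by (simp add: \<phi>_def Q_def l_def vector_2 matrix_vector_mult_scaleR power2_eq_square algebra_simps)
  qed
  with Q show "a * l\<^sub>1 + b * l\<^sub>2 \<le> - \<nu>\<^sub>1 * ((a * p)\<^sup>2 + (b * q)\<^sup>2)"
    by (simp add: l_def mult.commute)
  \<comment> \<open>The value \<open>1 / (\<nu>\<^sub>2 * h)\<close> minimises the model
    \<open>t\<^sup>2 * \<nu>\<^sub>2 * p\<^sup>2 / 2 - t * p\<^sup>2 / h\<close>; the cap at 1 keeps
    \<open>(t, 0)\<close> feasible. The curvature term then consumes at most half of the linear
    decrease.\<close>
  define t where "t = min 1 (1 / (\<nu>\<^sub>2 * h))"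
  have t: "0 < t" "t \<le> 1" "t * \<nu>\<^sub>2 \<le> 1 / h"
    using nu h by (auto simp: t_def min_def field_simps)
  have "l \<le> \<phi> (vector [a, b])"
    using Q0 by (simp add: \<phi>_def Q_def l_def vector_2)
  also have "\<dots> \<le> \<phi> (vector [t, 0])" using t by (intro min) auto
  also have "\<dots> = t * (t * A$1$1) * (p\<^sup>2 / 2) + t * l\<^sub>1"
    by (simp add: \<phi>_def inner_vec_def matrix_vector_mult_def sum_2 vector_2 power2_eq_square)
  also have "\<dots> \<le> t * (1 / h) * (p\<^sup>2 / 2) + t * (- p\<^sup>2 / h)"
  proof (intro add_mono mult_left_mono mult_right_mono)
    show "t * A$1$1 \<le> 1 / h"
      using t nu mult_left_mono[of "A$1$1" \<nu>\<^sub>2 t] by linarith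
    show "l\<^sub>1 \<le> - p\<^sup>2 / h" using h by (simp add: field_simps)
  qed (use t in auto)
  also have "\<dots> = - (t / (2 * h)) * p\<^sup>2" using h by (simp add: field_simps)
  finally show "a * l\<^sub>1 + b * l\<^sub>2 \<le> - (min 1 (1 / (\<nu>\<^sub>2 * h)) / (2 * h)) * p\<^sup>2"
    by (simp add: l_def t_def)
qed

section \<open>Constants of the direction assumption, uniform over the iterates\<close>

theorem proposition4p3:
  fixes S \<D> :: "(real^'n) set"
    and f :: "real^'n \<Rightarrow> real"
    and gradf :: "real^'n \<Rightarrow> real^'n"
    and L \<nu>\<^sub>1 \<nu>\<^sub>2 \<eta>\<^sub>m\<^sub>i\<^sub>n \<eta>\<^sub>m\<^sub>a\<^sub>x :: real
    and Hhat H D :: "nat \<Rightarrow> real^2^2"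
    and \<eta>s \<alpha> \<beta> :: "nat \<Rightarrow> real"
    and x dhat shat d :: "nat \<Rightarrow> real^'n"
  assumes S: "S \<noteq> {}" "closed S" "convex S"
    and f_smooth: "\<forall>y. GDERIV f y :> gradf y" "continuous_on UNIV gradf"
    and f_bdd: "bdd_below (f ` S)"
    and f_lip: "open \<D>" "convex \<D>" "S \<subseteq> \<D>" "L-lipschitz_on \<D> gradf"
    and nu: "0 < \<nu>\<^sub>1" "\<nu>\<^sub>1 \<le> \<nu>\<^sub>2"
    and Hhat: "\<forall>k\<ge>1. transpose (Hhat k) = Hhat k \<and> pos_def (Hhat k)"
    and Hhat_bounds: "\<forall>k\<ge>1. \<nu>\<^sub>1 \<le> lambda_min (Hhat k) \<and> Hhat k $ 1 $ 1 \<le> \<nu>\<^sub>2"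
    and eta: "0 < \<eta>\<^sub>m\<^sub>i\<^sub>n" "\<eta>\<^sub>m\<^sub>i\<^sub>n \<le> \<eta>\<^sub>m\<^sub>a\<^sub>x" "\<eta>\<^sub>m\<^sub>a\<^sub>x < 2 / \<nu>\<^sub>1"
    and etas: "\<forall>k\<ge>1. \<eta>\<^sub>m\<^sub>i\<^sub>n \<le> \<eta>s k \<and> \<eta>s k \<le> \<eta>\<^sub>m\<^sub>a\<^sub>x"
    and x: "\<forall>k. x k \<in> S"
    and dhat: "\<forall>k\<ge>1. dhat k = closest_point S (x k - \<eta>s k *\<^sub>R gradf (x k)) - x k"
    and shat: "\<forall>k\<ge>1. shat k = closest_point S (x k + (x k - x (k - 1))) - x k"
    and D: "\<forall>k\<ge>1. D k = vector [vector [norm (dhat k), 0], vector [0, norm (shat k)]]"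
    and H: "\<forall>k\<ge>1. H k = D k ** Hhat k ** D k"
    and opt: "\<forall>k\<ge>1. is_arg_min
        (\<lambda>u. 1/2 * (u \<bullet> (H k *v u)) + u$1 * (gradf (x k) \<bullet> dhat k) + u$2 * (gradf (x k) \<bullet> shat k))
        (\<lambda>u. u$1 + u$2 \<le> 1 \<and> u$1 \<ge> 0 \<and> u$2 \<ge> 0)
        (vector [\<alpha> k, \<beta> k] :: real^2)"
    and d: "\<forall>k\<ge>1. d k = \<alpha> k *\<^sub>R dhat k + \<beta> k *\<^sub>R shat k"
  shows "\<forall>\<eta>\<in>{\<eta>\<^sub>m\<^sub>i\<^sub>n..\<eta>\<^sub>m\<^sub>a\<^sub>x}. direction_assumption S gradf \<eta> x d"
proof
  fix \<eta> assume \<eta>: "\<eta> \<in> {\<eta>\<^sub>m\<^sub>i\<^sub>n..\<eta>\<^sub>m\<^sub>a\<^sub>x}"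
  \<comment> \<open>\<open>\<tau>\<close> is the second subproblem constant at
    \<open>h = \<eta>\<^sub>m\<^sub>a\<^sub>x\<close>, and \<open>\<rho>\<close> the largest
    possible ratio of two admissible step sizes.\<close>
  define \<tau> where "\<tau> = min 1 (1 / (\<nu>\<^sub>2 * \<eta>\<^sub>m\<^sub>a\<^sub>x)) / (2 * \<eta>\<^sub>m\<^sub>a\<^sub>x)"
  define \<rho> where "\<rho> = \<eta>\<^sub>m\<^sub>a\<^sub>x / \<eta>\<^sub>m\<^sub>i\<^sub>n"
  have pos: "0 < \<tau>" "0 < \<rho>" "1 \<le> \<rho>" "0 < \<nu>\<^sub>2" "0 < \<eta>\<^sub>m\<^sub>a\<^sub>x"
    using nu eta by (auto simp: \<tau>_def \<rho>_def)
  show "direction_assumption S gradf \<eta> x d"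
    unfolding direction_assumption_def
  \<comment> \<open>The full step 1 works because \<alpha> + \<beta> \<le> 1. The half in
    \<open>\<nu>\<^sub>1 / 2\<close> pays for bounding the square of a sum by twice the sum of
    squares; dividing by \<open>\<rho>\<^sup>2\<close> pays for the change of step size.\<close>
  proof (rule exI[of _ 1], rule exI[of _ "\<nu>\<^sub>1 / 2"], rule exI[of _ "\<tau> / \<rho>\<^sup>2"],
      intro conjI allI impI ballI)
    fix k :: nat assume k: "k \<ge> 1"
    define g where "g = gradf (x k)"
    define p where "p = norm (dhat k)"
    define q where "q = norm (shat k)"
    have xk: "x k \<in> S" using x by simp
    have ek: "0 < \<eta>s k" "\<eta>\<^sub>m\<^sub>i\<^sub>n \<le> \<eta>s k" "\<eta>s k \<le> \<eta>\<^sub>m\<^sub>a\<^sub>x" using etas eta k by force+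
    have dk: "dhat k = closest_point S (x k - \<eta>s k *\<^sub>R g) - x k"
      using dhat k by (simp add: g_def)
    have desc: "\<eta>s k * (g \<bullet> dhat k) \<le> - p\<^sup>2"
      unfolding dk p_def by (rule projected_step_descent) (use S xk in auto)
    \<comment> \<open>Since the slope is nonpositive, enlarging \<open>\<eta>s k\<close> to
      \<open>\<eta>\<^sub>m\<^sub>a\<^sub>x\<close> preserves the descent inequality and removes the
      dependence on \<open>k\<close>.\<close>
    then have "g \<bullet> dhat k \<le> 0"
      using ek(1) by (smt (verit) mult_pos_pos zero_le_power2)
    then have "\<eta>\<^sub>m\<^sub>a\<^sub>x * (g \<bullet> dhat k) \<le> - p\<^sup>2"
      using desc ek(3) mult_right_mono_neg[of "\<eta>s k" "\<eta>\<^sub>m\<^sub>a\<^sub>x" "g \<bullet> dhat k"] by linarith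
    note bounds = subproblem_solution_bounds[where A = "Hhat k" and p = p and q = q
        and a = "\<alpha> k" and b = "\<beta> k" and l\<^sub>1 = "g \<bullet> dhat k" and l\<^sub>2 = "g \<bullet> shat k"
        and h = "\<eta>\<^sub>m\<^sub>a\<^sub>x" and \<nu>\<^sub>1 = \<nu>\<^sub>1 and \<nu>\<^sub>2 = \<nu>\<^sub>2, OF _ nu(1) _ pos(4) _ pos(5) this]
    have gd: "g \<bullet> d k = \<alpha> k * (g \<bullet> dhat k) + \<beta> k * (g \<bullet> shat k)"
      using d k by (simp add: inner_simps)
    have optk: "is_arg_min (\<lambda>u. 1/2 * (u \<bullet> ((vector [vector [p, 0], vector [0, q]] ** Hhat k
            ** vector [vector [p, 0], vector [0, q]]) *v u)) + u$1 * (g \<bullet> dhat k) + u$2 * (g \<bullet> shat k))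
        (\<lambda>u. u$1 + u$2 \<le> 1 \<and> u$1 \<ge> 0 \<and> u$2 \<ge> 0) (vector [\<alpha> k, \<beta> k] :: real^2)"
      using opt[rule_format, OF k] H[rule_format, OF k] D[rule_format, OF k]
      by (simp add: g_def p_def q_def)
    have b1: "g \<bullet> d k \<le> - \<nu>\<^sub>1 * ((\<alpha> k * p)\<^sup>2 + (\<beta> k * q)\<^sup>2)" and b2: "g \<bullet> d k \<le> - \<tau> * p\<^sup>2"
      using bounds[OF _ _ _ optk] Hhat Hhat_bounds k by (auto simp: gd \<tau>_def)
    have ab: "\<alpha> k + \<beta> k \<le> 1" "\<alpha> k \<ge> 0" "\<beta> k \<ge> 0"
      using opt k by (auto simp: is_arg_min_def vector_2)
    show "x k + t *\<^sub>R d k \<in> S" if "t \<in> {0..1}" for t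
    proof -
      have "x k + dhat k \<in> S" "x k + shat k \<in> S"
        using dhat shat k S by (auto intro!: closest_point_in_set)
      moreover have "t * \<alpha> k + t * \<beta> k \<le> 1"
        using ab that mult_mono[of t 1 "\<alpha> k + \<beta> k" 1] by (simp add: distrib_left)
      ultimately have "x k + ((t * \<alpha> k) *\<^sub>R dhat k + (t * \<beta> k) *\<^sub>R shat k) \<in> S"
        using S xk ab that by (intro convex_two_directions) auto
      then show ?thesis using d k by (simp add: algebra_simps)
    qed
    show "gradf (x k) \<bullet> d k \<le> - (\<nu>\<^sub>1 / 2) * (norm (d k))\<^sup>2"
    proof -
      have "norm (d k) \<le> \<alpha> k * p + \<beta> k * q"
        using d k ab norm_triangle_ineq[of "\<alpha> k *\<^sub>R dhat k" "\<beta> k *\<^sub>R shat k"] by (simp add: p_def q_def)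
      then have "(norm (d k))\<^sup>2 \<le> (\<alpha> k * p + \<beta> k * q)\<^sup>2" by (intro power_mono) auto
      also have "\<dots> \<le> 2 * ((\<alpha> k * p)\<^sup>2 + (\<beta> k * q)\<^sup>2)"
        using sum_squares_bound[of "\<alpha> k * p" "\<beta> k * q"] by (simp add: power2_sum)
      finally have "\<nu>\<^sub>1 / 2 * (norm (d k))\<^sup>2 \<le> \<nu>\<^sub>1 / 2 * (2 * ((\<alpha> k * p)\<^sup>2 + (\<beta> k * q)\<^sup>2))"
        using nu(1) by (intro mult_left_mono) auto
      then show ?thesis using b1 by (simp add: g_def algebra_simps)
    qed
    define r where "r = norm (closest_point S (x k - \<eta> *\<^sub>R gradf (x k)) - x k)"
    \<comment> \<open>The step with the fixed \<open>\<eta>\<close> is compared with the actual step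
      of length \<open>p\<close>; as \<open>\<rho>\<close> is at least 1, it absorbs both arguments
      of the maximum.\<close>
    have "r \<le> max 1 (\<eta> / \<eta>s k) * p"
      unfolding r_def p_def dk g_def
      by (rule projected_step_norm_le) (use S \<eta> eta ek in auto)
    also have "\<dots> \<le> \<rho> * p"
    proof (rule mult_right_mono)
      have "\<eta> / \<eta>s k \<le> \<rho>"
        unfolding \<rho>_def using \<eta> eta ek by (intro frac_le) auto
      then show "max 1 (\<eta> / \<eta>s k) \<le> \<rho>" using pos by simp
    qed (simp add: p_def)
    finally have "r\<^sup>2 \<le> (\<rho> * p)\<^sup>2" by (intro power_mono) (auto simp: r_def)
    then have "\<tau> / \<rho>\<^sup>2 * r\<^sup>2 \<le> \<tau> / \<rho>\<^sup>2 * (\<rho> * p)\<^sup>2"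
      using pos by (intro mult_left_mono) auto
    also have "\<dots> = \<tau> * p\<^sup>2" using pos(2) by (simp add: power_mult_distrib)
    finally show "gradf (x k) \<bullet> d k
        \<le> - (\<tau> / \<rho>\<^sup>2) * (norm (closest_point S (x k - \<eta> *\<^sub>R gradf (x k)) - x k))\<^sup>2"
      using b2 unfolding g_def r_def by linarith
  qed (use pos(1,2) nu(1) in simp_all)
qed

end
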